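(* Let $\mathcal A,\mathcal E$ be finite sets, $P_{A,E}$ a probability distribution on $\mathcal A\times\mathcal E$, $\mathsf M$ a positive integer and $\varepsilon>0$. Then $$\underline\Delta_{I,\min}(\mathsf M,\varepsilon|P_{A,E})\le\min_{R'}\Bigl[\eta\bigl(P_{A,E}\{(a,e):P_{A|E}(a|e)>e^{-R'}\},\log\mathsf M\bigr)+\log(1+\varepsilon\mathsf M e^{-R'})\Bigr]$$ $$\le\min_{R'}\Bigl[\eta\bigl(\min_{s\ge0}e^{s(R'-H_{1+s}^\downarrow(A|E|P_{A,E}))},\log\mathsf M\bigr)+\log(1+\varepsilon\mathsf M e^{-R'})\Bigr],$$ where $R'$ ranges over $\mathbb R$ and minima are understood as infima.
   Context: Logarithms are natural. A sub-distribution is a nonnegative function with total sum $\le1$; $P_E(e)=\sum_aP_{A,E}(a,e)$; $P_{A|E}(a|e)=P_{A,E}(a,e)/P_E(e)$; $P_{A,E}(\Omega)=\sum_{(a,e)\in\Omega}P_{A,E}(a,e)$; $\|\cdot\|_1$ is the sum of absolute values; $\eta(x,y)=xy-x\log x$ with $\eta(0,y)=0$. For $s>0$, $H_{1+s}^\downarrow(A|E|P_{A,E})=-\frac1s\log\sum_{a,e}P_{A,E}(a,e)^{1+s}P_E(e)^{-s}$, and $H_1^\downarrow$ is the conditional Shannon entropy. $H_{\min}(A|E|P'\|P_E)\ge r$ means $P'(a,e)\le e^{-r}P_E(e)$ for all $(a,e)$. With the minimum over $r$ understood as an infimum, $$\underline\Delta_{I,\min}(\mathsf M,\varepsilon|P_{A,E})=\min_{r\in\mathbb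 R}\Bigl[\eta\Bigl(\min_{P'_{A,E}:\,P'_E\le P_E,\ H_{\min}(A|E|P'_{A,E}\|P_E)\ge r}\|P_{A,E}-P'_{A,E}\|_1,\ \log\mathsf M\Bigr)+\log\bigl(1+\varepsilon\mathsf M e^{-r}\bigr)\Bigr],$$ where $P'_{A,E}$ ranges over sub-distributions on $\mathcal A\times\mathcal E$. *)

theory Defs
  imports Complex_Main
begin

text \<open>
  Functions on a finite product type stand for functions on
  \<open>\<A> \<times> \<E>\<close>. All minima are infima, written as
  \<open>INF\<close> over the reals. Every infimum below, for a probability distribution
  \<open>P\<close> and a positive integer \<open>M\<close>, is over a nonempty family bounded below
  by 0, so it is a genuine infimum: the argument of \<open>eta\<close> always lies in
  \<open>[0,1]\<close> (take \<open>P' = 0\<close> in \<open>min_dist\<close>, or \<open>s = 0\<close> in the infimum over \<open>s\<close>),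
  and there \<open>eta x (ln M) \<ge> 0\<close>.
\<close>

definition prob_dist :: "('a::finite \<times> 'e::finite \<Rightarrow> real) \<Rightarrow> bool" where
  "prob_dist P \<longleftrightarrow> (\<forall>x. 0 \<le> P x) \<and> (\<Sum>x\<in>UNIV. P x) = 1"

definition sub_dist :: "('a::finite \<times> 'e::finite \<Rightarrow> real) \<Rightarrow> bool" where
  "sub_dist P \<longleftrightarrow> (\<forall>x. 0 \<le> P x) \<and> (\<Sum>x\<in>UNIV. P x) \<le> 1"

definition marginal_E :: "('a::finite \<times> 'e::finite \<Rightarrow> real) \<Rightarrow> 'e \<Rightarrow> real" where
  "marginal_E P e = (\<Sum>a\<in>UNIV. P (a, e))"

text \<open>If \<open>P\<^sub>E(e) = 0\<close> this takes the value 0; then \<open>P (a, e) = 0\<close> as well, and such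
  points contribute nothing to any of the sums below.\<close>

definition cond_prob :: "('a::finite \<times> 'e::finite \<Rightarrow> real) \<Rightarrow> 'a \<Rightarrow> 'e \<Rightarrow> real" where
  "cond_prob P a e = P (a, e) / marginal_E P e"

definition l1_norm :: "('a::finite \<times> 'e::finite \<Rightarrow> real) \<Rightarrow> real" where
  "l1_norm f = (\<Sum>x\<in>UNIV. \<bar>f x\<bar>)"

definition eta :: "real \<Rightarrow> real \<Rightarrow> real" where
  "eta x y = (if x = 0 then 0 else x * y - x * ln x)"

text \<open>Since \<open>ln 0 = 0\<close>, the convention \<open>0 log 0 = 0\<close> is built in.\<close>

definition cond_shannon_entropy :: "('a::finite \<times> 'e::finite \<Rightarrow> real) \<Rightarrow> real" where
  "cond_shannon_entropy P = - (\<Sum>a\<in>UNIV. \<Sum>e\<in>UNIV. P (a, e) * ln (cond_prob P a e))"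

text \<open>\<open>H_down s P\<close> is \<open>H\<^sub>1\<^sub>+\<^sub>s\<^sup>\<down>(A|E|P)\<close>, used for \<open>s \<ge> 0\<close> only. Since \<open>0 powr t = 0\<close>,
  terms with \<open>P\<^sub>E(e) = 0\<close> vanish.\<close>

definition H_down :: "real \<Rightarrow> ('a::finite \<times> 'e::finite \<Rightarrow> real) \<Rightarrow> real" where
  "H_down s P =
    (if s = 0 then cond_shannon_entropy P
     else - (1 / s) * ln (\<Sum>a\<in>UNIV. \<Sum>e\<in>UNIV. P (a, e) powr (1 + s) * marginal_E P e powr (- s)))"

text \<open>\<open>H_min_ge P' Q r\<close> is \<open>H\<^sub>m\<^sub>i\<^sub>n(A|E|P' \<parallel> Q) \<ge> r\<close>.\<close>

definition H_min_ge :: "('a::finite \<times> 'e::finite \<Rightarrow> real) \<Rightarrow> ('e \<Rightarrow> real) \<Rightarrow> real \<Rightarrow> bool" where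
  "H_min_ge P' Q r \<longleftrightarrow> (\<forall>a e. P' (a, e) \<le> exp (- r) * Q e)"

definition min_dist :: "('a::finite \<times> 'e::finite \<Rightarrow> real) \<Rightarrow> real \<Rightarrow> real" where
  "min_dist P r =
    (INF P'\<in>{P'. sub_dist P' \<and> (\<forall>e. marginal_E P' e \<le> marginal_E P e)
                 \<and> H_min_ge P' (marginal_E P) r}.
       l1_norm (\<lambda>x. P x - P' x))"

definition Delta_I_min :: "nat \<Rightarrow> real \<Rightarrow> ('a::finite \<times> 'e::finite \<Rightarrow> real) \<Rightarrow> real" where
  "Delta_I_min M \<epsilon> P =
    (INF r::real. eta (min_dist P r) (ln (real M)) + ln (1 + \<epsilon> * real M * exp (- r)))"

end

(* The function eta(., y) need not be increasing on [0,1]: for M = 1, 2 its maximum lies below 1.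
   It is concave, though, so eta(z) >= min(eta(x), eta(1)) whenever x <= z <= 1. The value eta(1) = y
   is harmless, because all the infima are at most y: as r tends to infinity the first arguments
   of eta tend to 1 and the logarithmic penalty tends to 0. Hence a pointwise comparison
   of the first arguments suffices. The first comparison truncates P to the complement of
   {P(a|e) > exp(-R)}, the second is Markov's inequality for the s-th power of P(a|e). *)

theory Submission
  imports Defs
begin

section \<open>Concavity of \<open>eta\<close> and comparison of infima\<close>

lemma eta_eq: "eta x y = x * y - x * ln x"
  by (simp add: eta_def)

lemma eta_nonneg:
  assumes "0 \<le> x" "x \<le> 1" "0 \<le> y"
  shows "0 \<le> eta x y"
proof -
  have "x * ln x \<le> 0"
    using assms by (cases "x = 0") (simp_all add: mult_nonneg_nonpos)
  moreover have "0 \<le> x * y"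
    using assms by simp
  ultimately show ?thesis
    by (simp add: eta_eq)
qed

text \<open>Concavity in the first argument: \<open>y - ln z - 1\<close> is the slope at
  \<open>z\<close>, and the estimate reduces to \<open>ln t \<le> t - 1\<close> at
  \<open>t = z / x\<close>.\<close>

lemma eta_le_tangent:
  assumes "0 < x" "0 < z"
  shows "eta x y \<le> eta z y + (x - z) * (y - ln z - 1)"
proof -
  have "x * ln (z / x) \<le> x * (z / x - 1)"
    using assms by (intro mult_left_mono ln_le_minus_one) auto
  then have "x * ln z - x * ln x \<le> z - x"
    using assms by (simp add: ln_div right_diff_distrib)
  then show ?thesis
    using assms by (simp add: eta_eq algebra_simps)
qed

text \<open>The sign of the slope at \<open>z\<close> decides. If it is nonnegative, the tangent at
  \<open>z\<close>, evaluated at \<open>x\<close>, gives \<open>eta x y \<le> eta z y\<close>;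
  otherwise its value at 1 shows \<open>eta 1 y = y \<le> eta z y\<close>. The tangent bound needs
  \<open>x > 0\<close>, so \<open>x = 0\<close> is settled by nonnegativity of
  \<open>eta z y\<close>.\<close>

lemma eta_ge_min:
  assumes "0 \<le> x" "x \<le> z" "z \<le> 1" "0 \<le> y"
  shows "min (eta x y) y \<le> eta z y"
proof (cases "x = 0")
  case True
  then show ?thesis
    using eta_nonneg[of z y] assms by (simp add: eta_eq[of 0] min_def)
next
  case False
  with assms have pos: "0 < x" "0 < z" by auto
  show ?thesis
  proof (cases "0 \<le> y - ln z - 1")
    case True
    with assms have "(x - z) * (y - ln z - 1) \<le> 0"
      by (simp add: mult_nonpos_nonneg)
    with eta_le_tangent[OF pos, of y] show ?thesis by linarith
  next
    case False
    with assms have "(1 - z) * (y - ln z - 1) \<le> 0"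
      by (simp add: mult_nonneg_nonpos)
    with eta_le_tangent[of 1 z y] pos show ?thesis by (simp add: eta_eq[of 1])
  qed
qed

lemma INF_eta_mono:
  fixes f h g :: "real \<Rightarrow> real"
  assumes f_nonneg: "\<And>r. 0 \<le> f r" and f_le: "\<And>r. f r \<le> h r" and h_le: "\<And>r. h r \<le> 1"
    and g_nonneg: "\<And>r. 0 \<le> g r" and y: "0 \<le> y"
    and f_lim: "(f \<longlongrightarrow> 1) at_top" and g_lim: "(g \<longlongrightarrow> 0) at_top"
  shows "(INF r. eta (f r) y + g r) \<le> (INF r. eta (h r) y + g r)"
proof -
  let ?I = "INF r. eta (f r) y + g r"
  have f_le_1: "f r \<le> 1" for r
    using f_le h_le by (rule order_trans)
  have "bdd_below (range (\<lambda>r. eta (f r) y + g r))"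
    by (rule bdd_belowI2[of _ 0]) (use eta_nonneg f_nonneg f_le_1 g_nonneg y in auto)
  then have I_le: "?I \<le> eta (f r) y + g r" for r
    by (rule cINF_lower) simp
  \<comment> \<open>Along large \<open>r\<close> the objective tends to
    \<open>eta 1 y + 0 = y\<close>, so its infimum cannot exceed \<open>y\<close>.\<close>
  have "((\<lambda>r. (f r * y - f r * ln (f r)) + g r) \<longlongrightarrow> (1 * y - 1 * ln 1) + 0) at_top"
    by (intro tendsto_intros f_lim g_lim) simp
  moreover have "\<forall>\<^sub>F r in at_top. ?I \<le> (f r * y - f r * ln (f r)) + g r"
    using I_le by (simp add: eta_eq)
  ultimately have "?I \<le> (1 * y - 1 * ln 1) + 0"
    using tendsto_lowerbound trivial_limit_at_top_linorder by blast
  then have I_le_y: "?I \<le> y" by simp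
  show ?thesis
  proof (rule cINF_greatest)
    fix r
    \<comment> \<open>Whichever value attains the minimum, adding \<open>g r\<close> gives at least
      \<open>?I\<close>: the first sum belongs to the family, the second is at least
      \<open>y\<close>.\<close>
    have "min (eta (f r) y) y \<le> eta (h r) y"
      by (rule eta_ge_min) (use f_nonneg f_le h_le y in auto)
    with I_le[of r] I_le_y g_nonneg[of r] show "?I \<le> eta (h r) y + g r"
      by linarith
  qed simp
qed

section \<open>Marginals and the distance to distributions of bounded min-entropy\<close>

lemma marginal_E_nonneg: "prob_dist P \<Longrightarrow> 0 \<le> marginal_E P e"
  by (simp add: marginal_E_def prob_dist_def sum_nonneg)

lemma le_marginal_E: "prob_dist P \<Longrightarrow> P (a, e) \<le> marginal_E P e"
  unfolding marginal_E_def prob_dist_def by (rule member_le_sum) auto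

lemma sum_marginal_E:
  fixes P :: "'a::finite \<times> 'e::finite \<Rightarrow> real"
  shows "(\<Sum>e\<in>UNIV. marginal_E P e) = (\<Sum>x\<in>UNIV. P x)"
proof -
  have "(\<Sum>e\<in>UNIV. marginal_E P e) = (\<Sum>a\<in>UNIV. \<Sum>e\<in>UNIV. P (a, e))"
    unfolding marginal_E_def by (rule sum.swap)
  then show ?thesis
    by (simp add: sum.cartesian_product)
qed

lemma l1_norm_nonneg: "0 \<le> l1_norm f"
  by (simp add: l1_norm_def sum_nonneg)

lemma min_dist_le:
  assumes "sub_dist P'" "\<And>e. marginal_E P' e \<le> marginal_E P e" "H_min_ge P' (marginal_E P) r"
  shows "min_dist P r \<le> l1_norm (\<lambda>x. P x - P' x)"
  unfolding min_dist_def
  by (rule cINF_lower) (use assms l1_norm_nonneg in \<open>auto intro!: bdd_belowI2[of _ 0]\<close>)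

lemma min_dist_ge:
  assumes "prob_dist P"
    and "\<And>P'. sub_dist P' \<Longrightarrow> \<forall>e. marginal_E P' e \<le> marginal_E P e \<Longrightarrow>
           H_min_ge P' (marginal_E P) r \<Longrightarrow> c \<le> l1_norm (\<lambda>x. P x - P' x)"
  shows "c \<le> min_dist P r"
  unfolding min_dist_def
proof (rule cINF_greatest)
  \<comment> \<open>The zero sub-distribution is admissible for every \<open>r\<close>, so the
    infimum is over a nonempty set.\<close>
  have "(\<lambda>x. 0) \<in> {P'. sub_dist P' \<and> (\<forall>e. marginal_E P' e \<le> marginal_E P e)
                 \<and> H_min_ge P' (marginal_E P) r}"
    using marginal_E_nonneg[OF assms(1)] by (simp add: sub_dist_def marginal_E_def H_min_ge_def)
  then show "{P'. sub_dist P' \<and> (\<forall>e. marginal_E P' e \<le> marginal_E P e)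
                 \<and> H_min_ge P' (marginal_E P) r} \<noteq> {}"
    by blast
qed (use assms(2) in blast)

lemma min_dist_nonneg: "prob_dist P \<Longrightarrow> 0 \<le> min_dist P r"
  by (rule min_dist_ge) (auto simp: l1_norm_nonneg)

text \<open>Summing the min-entropy constraint over all points leaves any admissible
  \<open>P'\<close> a total mass of at most |A| times \<open>exp (- r)\<close>; the mass missing
  from 1 is a lower bound for the distance. This forces \<open>min_dist P r\<close> towards 1 for
  large \<open>r\<close>.\<close>

lemma min_dist_ge_one_minus:
  fixes P :: "'a::finite \<times> 'e::finite \<Rightarrow> real"
  assumes "prob_dist P"
  shows "1 - real (card (UNIV :: 'a set)) * exp (- r) \<le> min_dist P r"
  using assms
proof (rule min_dist_ge)
  fix P' :: "'a \<times> 'e \<Rightarrow> real"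
  assume "H_min_ge P' (marginal_E P) r"
  then have "(\<Sum>a\<in>UNIV. \<Sum>e\<in>UNIV. P' (a, e)) \<le> (\<Sum>a::'a\<in>UNIV. \<Sum>e\<in>UNIV. exp (- r) * marginal_E P e)"
    unfolding H_min_ge_def by (intro sum_mono) auto
  also have "\<dots> = real (card (UNIV :: 'a set)) * exp (- r)"
    using assms by (simp add: sum_distrib_left[symmetric] sum_marginal_E prob_dist_def)
  finally have "(\<Sum>x\<in>UNIV. P' x) \<le> real (card (UNIV :: 'a set)) * exp (- r)"
    by (simp add: sum.cartesian_product)
  then have "1 - real (card (UNIV :: 'a set)) * exp (- r) \<le> (\<Sum>x\<in>UNIV. P x - P' x)"
    using assms by (simp add: sum_subtractf prob_dist_def)
  also have "\<dots> \<le> l1_norm (\<lambda>x. P x - P' x)"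
    unfolding l1_norm_def by (intro sum_mono) auto
  finally show "1 - real (card (UNIV :: 'a set)) * exp (- r) \<le> l1_norm (\<lambda>x. P x - P' x)" .
qed

section \<open>Bounds on the tail of the conditional probability\<close>

definition tail_prob :: "('a::finite \<times> 'e::finite \<Rightarrow> real) \<Rightarrow> real \<Rightarrow> real" where
  "tail_prob P r = (\<Sum>(a, e)\<in>{(a, e). cond_prob P a e > exp (- r)}. P (a, e))"

lemma tail_prob_le_1: "prob_dist P \<Longrightarrow> tail_prob P r \<le> 1"
  unfolding tail_prob_def prob_dist_def
  \<comment> \<open>The total mass of \<open>P\<close> takes the place of 1, which leaves
    monotonicity of the sum in its index set.\<close>
  by (subst case_prod_eta[of P], elim conjE, erule subst, rule sum_mono2) auto

lemma min_dist_le_tail_prob: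
  fixes P :: "'a::finite \<times> 'e::finite \<Rightarrow> real"
  assumes P: "prob_dist P"
  shows "min_dist P r \<le> tail_prob P r"
proof -
  let ?\<Omega> = "{(a, e). cond_prob P a e > exp (- r)}"
  define P' where "P' = (\<lambda>x. if x \<in> ?\<Omega> then 0 else P x)"
  have P0: "0 \<le> P x" for x
    using P unfolding prob_dist_def by blast
  have P'_le: "P' x \<le> P x" and P'0: "0 \<le> P' x" for x
    using P0 by (auto simp: P'_def)
  have "sum P' UNIV \<le> sum P UNIV"
    using P'_le by (rule sum_mono)
  then have "sub_dist P'"
    using P P'0 by (simp add: sub_dist_def prob_dist_def)
  moreover have "marginal_E P' e \<le> marginal_E P e" for e
    unfolding marginal_E_def by (rule sum_mono) (rule P'_le)
  moreover have "P' (a, e) \<le> exp (- r) * marginal_E P e" for a e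
  \<comment> \<open>Where the marginal vanishes, division by zero makes \<open>cond_prob\<close> 0,
    so nothing is cut off there; the bound holds because \<open>P\<close> itself vanishes.\<close>
  proof (cases "marginal_E P e = 0")
    case True
    then show ?thesis
      using P'_le[of "(a, e)"] le_marginal_E[OF P, of a e] by simp
  next
    case False
    then have "0 < marginal_E P e"
      using marginal_E_nonneg[OF P, of e] by simp
    then show ?thesis
      by (auto simp: P'_def cond_prob_def field_simps)
  qed
  then have "H_min_ge P' (marginal_E P) r"
    by (simp add: H_min_ge_def)
  ultimately have "min_dist P r \<le> l1_norm (\<lambda>x. P x - P' x)"
    by (rule min_dist_le)
  also have "\<dots> = (\<Sum>x\<in>UNIV. if x \<in> ?\<Omega> then P x else 0)"
    unfolding l1_norm_def by (rule sum.cong) (auto simp: P'_def P0)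
  also have "\<dots> = tail_prob P r"
    unfolding tail_prob_def by (simp add: sum.If_cases case_prod_eta)
  finally show ?thesis .
qed

text \<open>For \<open>s > 0\<close>, \<open>exp (- s * H_down s P)\<close> is the expectation under
  \<open>P\<close> of the \<open>s\<close>-th power of \<open>cond_prob\<close>, and
  \<open>exp (s * r)\<close> is the inverse of the threshold \<open>exp (- r)\<close> raised to the
  power \<open>s\<close>.\<close>

lemma tail_prob_le_exp_H_down:
  fixes P :: "'a::finite \<times> 'e::finite \<Rightarrow> real"
  assumes P: "prob_dist P" and s: "0 \<le> s"
  shows "tail_prob P r \<le> exp (s * (r - H_down s P))"
proof (cases "s = 0")
  \<comment> \<open>At \<open>s = 0\<close> the exponent is 0 whatever the entropy is, so the bound
    equals 1.\<close>
  case True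
  then show ?thesis
    using tail_prob_le_1[OF P] by simp
next
  case False
  with s have s: "0 < s" by simp
  have P0: "0 \<le> P x" for x
    using P unfolding prob_dist_def by blast
  define T where "T = (\<lambda>(a, e). P (a, e) powr (1 + s) * marginal_E P e powr (- s))"
  have T0: "0 \<le> T x" for x
    by (simp add: T_def split: prod.split)
  have T_eq: "T (a, e) = P (a, e) * cond_prob P a e powr s" for a e
    using P0 marginal_E_nonneg[OF P, of e]
    by (simp add: T_def cond_prob_def powr_add powr_minus_divide powr_divide)
  \<comment> \<open>A point of positive mass makes the sum of \<open>T\<close> positive, so that the
    exponential cancels the logarithm in \<open>H_down\<close>.\<close>
  obtain a e where ae: "0 < P (a, e)"
  proof -
    have "\<exists>x. P x \<noteq> 0"
      using P sum.neutral[of UNIV P] unfolding prob_dist_def by auto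
    then show ?thesis
      using P0 that by (metis less_eq_real_def surj_pair)
  qed
  then have "0 < marginal_E P e"
    using le_marginal_E[OF P, of a e] by simp
  with ae have "0 < T (a, e)"
    by (simp add: T_def)
  then have S_pos: "0 < (\<Sum>x\<in>UNIV. T x)"
    using T0 by (intro sum_pos2[of _ "(a, e)"]) auto
  have "(\<Sum>a\<in>UNIV. \<Sum>e\<in>UNIV. P (a, e) powr (1 + s) * marginal_E P e powr (- s)) = (\<Sum>x\<in>UNIV. T x)"
    by (simp add: T_def sum.cartesian_product)
  then have "s * (r - H_down s P) = s * r + ln (\<Sum>x\<in>UNIV. T x)"
    using s by (simp add: H_down_def field_simps)
  then have rhs: "exp (s * (r - H_down s P)) = (\<Sum>x\<in>UNIV. exp (s * r) * T x)"
    using S_pos by (simp add: exp_add sum_distrib_left)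
  have "tail_prob P r \<le> (\<Sum>x\<in>{(a, e). cond_prob P a e > exp (- r)}. exp (s * r) * T x)"
    unfolding tail_prob_def
  proof (rule sum_mono, clarify)
    fix a e
    assume "exp (- r) < cond_prob P a e"
    then have "exp (- (s * r)) \<le> cond_prob P a e powr s"
      using s powr_mono2[of s "exp (- r)" "cond_prob P a e"] by (simp add: exp_powr_real mult.commute)
    then have "exp (s * r) * exp (- (s * r)) \<le> exp (s * r) * cond_prob P a e powr s"
      by (rule mult_left_mono) simp
    then have "1 \<le> exp (s * r) * cond_prob P a e powr s"
      by (simp add: exp_minus)
    then show "P (a, e) \<le> exp (s * r) * T (a, e)"
      using mult_left_mono[OF _ P0, of 1 _ "(a, e)"] by (simp add: T_eq mult.left_commute)
  qed
  also have "\<dots> \<le> (\<Sum>x\<in>UNIV. exp (s * r) * T x)"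
    by (rule sum_mono2) (auto simp: T0)
  finally show ?thesis
    by (simp add: rhs)
qed

theorem theorem31:
  fixes P :: "'a::finite \<times> 'e::finite \<Rightarrow> real"
    and M :: nat and \<epsilon> :: real
  assumes "prob_dist P"
    and "M > 0"
    and "\<epsilon> > 0"
  shows "Delta_I_min M \<epsilon> P
           \<le> (INF R'::real. eta (\<Sum>(a, e)\<in>{(a, e). cond_prob P a e > exp (- R')}. P (a, e)) (ln (real M))
                             + ln (1 + \<epsilon> * real M * exp (- R')))
       \<and> (INF R'::real. eta (\<Sum>(a, e)\<in>{(a, e). cond_prob P a e > exp (- R')}. P (a, e)) (ln (real M))
                             + ln (1 + \<epsilon> * real M * exp (- R')))
           \<le> (INF R'::real. eta (INF s\<in>{0..}. exp (s * (R' - H_down s P))) (ln (real M))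
                             + ln (1 + \<epsilon> * real M * exp (- R')))"
proof -
  define g where "g = (\<lambda>r. ln (1 + \<epsilon> * real M * exp (- r)))"
  define h where "h = (\<lambda>r. INF s\<in>{0..}. exp (s * (r - H_down s P)))"
  have y: "0 \<le> ln (real M)"
    using \<open>M > 0\<close> by simp
  have g_nonneg: "0 \<le> g r" for r
    using \<open>\<epsilon> > 0\<close> by (simp add: g_def)
  have exp_lim: "((\<lambda>r::real. exp (- r)) \<longlongrightarrow> 0) at_top"
    using exp_at_bot filterlim_uminus_at_bot_at_top by (rule filterlim_compose)
  have "(g \<longlongrightarrow> ln (1 + \<epsilon> * real M * 0)) at_top"
    unfolding g_def by (intro tendsto_intros exp_lim) simp
  then have g_lim: "(g \<longlongrightarrow> 0) at_top" by simp
  \<comment> \<open>This common lower bound squeezes both \<open>min_dist P\<close> and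
    \<open>tail_prob P\<close> to 1.\<close>
  have "((\<lambda>r. 1 - real (card (UNIV :: 'a set)) * exp (- r)) \<longlongrightarrow> 1 - real (card (UNIV :: 'a set)) * 0) at_top"
    by (intro tendsto_intros exp_lim)
  then have lower_lim: "((\<lambda>r. 1 - real (card (UNIV :: 'a set)) * exp (- r)) \<longlongrightarrow> 1) at_top" by simp
  note P = \<open>prob_dist P\<close>
  have d_le: "min_dist P r \<le> 1" and t_nonneg: "0 \<le> tail_prob P r"
    and t_ge: "1 - real (card (UNIV :: 'a set)) * exp (- r) \<le> tail_prob P r" for r
    using min_dist_le_tail_prob[OF P, of r] tail_prob_le_1[OF P, of r]
      min_dist_nonneg[OF P, of r] min_dist_ge_one_minus[OF P, of r] by linarith+
  have d_lim: "(min_dist P \<longlongrightarrow> 1) at_top"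
    by (rule tendsto_sandwich[OF _ _ lower_lim tendsto_const])
       (simp_all add: min_dist_ge_one_minus P d_le)
  have t_lim: "(tail_prob P \<longlongrightarrow> 1) at_top"
    by (rule tendsto_sandwich[OF _ _ lower_lim tendsto_const])
       (simp_all add: t_ge tail_prob_le_1 P)
  have t_le_h: "tail_prob P r \<le> h r" for r
    unfolding h_def by (rule cINF_greatest) (auto simp: tail_prob_le_exp_H_down P)
  have h_le: "h r \<le> 1" for r
  proof -
    \<comment> \<open>The choice \<open>s = 0\<close> gives the value 1.\<close>
    have "h r \<le> exp (0 * (r - H_down 0 P))"
      unfolding h_def by (rule cINF_lower) (auto intro!: bdd_belowI2[of _ 0])
    then show ?thesis by simp
  qed
  have "Delta_I_min M \<epsilon> P \<le> (INF r. eta (tail_prob P r) (ln (real M)) + g r)"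
    unfolding Delta_I_min_def g_def
    by (rule INF_eta_mono[OF min_dist_nonneg[OF P] min_dist_le_tail_prob[OF P] tail_prob_le_1[OF P]
          g_nonneg y d_lim g_lim, unfolded g_def])
  moreover have "(INF r. eta (tail_prob P r) (ln (real M)) + g r) \<le> (INF r. eta (h r) (ln (real M)) + g r)"
    by (rule INF_eta_mono[OF t_nonneg t_le_h h_le g_nonneg y t_lim g_lim])
  ultimately show ?thesis
    unfolding tail_prob_def g_def h_def by blast
qed

end
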